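(* For all $p,\ell \in \mathbb{N}$, the $p$th central moment of $\mathrm{SSCC}$ over all pairs of binary sequences of length $\ell$ (uniformly distributed) is \[ \mu^\ell_{p,(f,g)}\,\mathrm{SSCC}(f,g) = \sum_{\mathcal{P} \in \mathrm{CCon}(p)} \left|\mathrm{CAs}(\mathcal{P},=,\ell)\right|. \]
   Context: $\mathbb{N}=\{0,1,2,\ldots\}$ and $[n]=\{0,1,\ldots,n-1\}$ for $n\in\mathbb{N}$. Moments. A binary sequence of length $\ell$ is a doubly infinite list $f=(f_j)_{j\in\mathbb{Z}}$ with $f_j\in\{-1,1\}$ for $j\in[\ell]$ and $f_j=0$ otherwise. The aperiodic crosscorrelation of $f$ with $g$ at shift $s\in\mathbb{Z}$ is $C_{f,g}(s)=\sum_{j\in\mathbb{Z}} f_{j+s}\overline{g_j}$, and $\mathrm{SSCC}(f,g)=\sum_{s\in\mathbb{Z}}|C_{f,g}(s)|^2$. $\mathrm{Pair}(\ell)$ is the set of all $2^{2\ell}$ ordered pairs of binary sequences of length $\ell$ with uniform probability measure, $\mathbb{E}^\ell_{(f,g)}$ is expectation with respect to it, and $\mu^\ell_{p,(f,g)} v(f,g)=\mathbb{E}^\ell_{(f,g)}\bigl(v(f,g)-\mathbb{E}^\ell_{(f,g)}v(f,g)\bigr)^p$. Assignments and partitions. Fix $p\in\mathbb{N}$. An assignment for $[p]$ is a function $\tau\colon[p]\times[2]\times[2]\to\mathbb{N}$, with values written $\tau_{e,s,v}$. Partitions have nonempty classes; $\mathrm{Part}(p)$ is the set of all partitions of $[p]\times[2]\times[2]$.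 A partition $\mathcal{P}\in\mathrm{Part}(p)$ is coherent if each of its classes is contained in $[p]\times[2]\times\{0\}$ or in $[p]\times[2]\times\{1\}$; $\mathrm{Coh}(p)$ is the set of coherent partitions in $\mathrm{Part}(p)$. For $\mathcal{P}\in\mathrm{Coh}(p)$: - $\mathrm{CAs}(\mathcal{P})$ is the set of assignments $\tau$ for $[p]$ such that for all $(e,s,v),(e',s',v')\in[p]\times[2]\times[2]$ with $v=v'$, we have $\tau_{e,s,v}=\tau_{e',s',v'}$ if and only if $(e,s,v)$ and $(e',s',v')$ lie in the same class of $\mathcal{P}$; - $\mathrm{CAs}(\mathcal{P},=)$ is the set of $\tau\in\mathrm{CAs}(\mathcal{P})$ with $\tau_{e,0,0}+\tau_{e,0,1}=\tau_{e,1,0}+\tau_{e,1,1}$ for all $e\in[p]$; - $\mathrm{CAs}(\mathcal{P},=,\ell)$ is the set of $\tau\in\mathrm{CAs}(\mathcal{P},=)$ all of whose values lie in $[\ell]$. $\mathcal{P}\in\mathrm{Coh}(p)$ is coherently satisfiable if $\mathrm{CAs}(\mathcal{P},=)\neq\emptyset$; $\mathrm{CSat}(p)$ is the set of such partitions. A partition is even if every class is a finite set of even cardinality. For $e\in[p]$, the restriction $\mathcal{P}_{\{e\}}$ is the partition $\{P\cap(\{e\}\times[2]\times[2]):P\in\mathcal{P}\}\smallsetminus\{\emptyset\}$ of $\{e\}\times[2]\times[2]$. $\mathcal{P}\in\mathrm{Part}(p)$ is globally even, locally odd (GELO) if $\mathcal{P}$ is even but $\mathcal{P}_{\{e\}}$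 is not even for every $e\in[p]$; $\mathrm{GELO}(p)$ is the set of such partitions. Finally $\mathrm{CCon}(p)=\mathrm{CSat}(p)\cap\mathrm{GELO}(p)$ is the set of coherently contributory partitions. *)

theory Defs
  imports "HOL-Probability.Probability"
begin

section \<open>Moments\<close>

definition binary_seqs :: "nat \<Rightarrow> (int \<Rightarrow> complex) set" where
  "binary_seqs l =
     {f. (\<forall>j\<in>{0..<int l}. f j \<in> {-1, 1}) \<and> (\<forall>j. j \<notin> {0..<int l} \<longrightarrow> f j = 0)}"

definition crosscorr :: "(int \<Rightarrow> complex) \<Rightarrow> (int \<Rightarrow> complex) \<Rightarrow> int \<Rightarrow> complex" where
  "crosscorr f g s = (\<Sum>\<^sub>\<infinity>j\<in>UNIV. f (j + s) * cnj (g j))"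

definition SSCC :: "(int \<Rightarrow> complex) \<Rightarrow> (int \<Rightarrow> complex) \<Rightarrow> real" where
  "SSCC f g = (\<Sum>\<^sub>\<infinity>s\<in>UNIV. (cmod (crosscorr f g s))\<^sup>2)"

definition seq_pairs :: "nat \<Rightarrow> ((int \<Rightarrow> complex) \<times> (int \<Rightarrow> complex)) set" where
  "seq_pairs l = binary_seqs l \<times> binary_seqs l"

text \<open>\<^const>\<open>pmf_of_set\<close> is meaningful here because \<^term>\<open>seq_pairs l\<close> is finite
  and nonempty for every \<open>l\<close>; for \<open>l = 0\<close> it is a singleton.\<close>

definition pair_expectation ::
    "nat \<Rightarrow> ((int \<Rightarrow> complex) \<times> (int \<Rightarrow> complex) \<Rightarrow> real) \<Rightarrow> real" where
  "pair_expectation l v = measure_pmf.expectation (pmf_of_set (seq_pairs l)) v"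

definition pair_central_moment ::
    "nat \<Rightarrow> nat \<Rightarrow> ((int \<Rightarrow> complex) \<times> (int \<Rightarrow> complex) \<Rightarrow> real) \<Rightarrow> real" where
  "pair_central_moment p l v = pair_expectation l (\<lambda>x. (v x - pair_expectation l v) ^ p)"

section \<open>Assignments and partitions\<close>

type_synonym index = "nat \<times> nat \<times> nat"

definition indices :: "nat \<Rightarrow> index set" where
  "indices p = {..<p} \<times> {..<2} \<times> {..<2}"

text \<open>Assignments are extensional functions (\<open>undefined\<close> outside \<^term>\<open>indices p\<close>), so that
  they correspond one-to-one to functions with domain \<^term>\<open>indices p\<close> and can be counted.\<close>

definition assignments :: "nat \<Rightarrow> (index \<Rightarrow> nat) set" where
  "assignments p = indices p \<rightarrow>\<^sub>E UNIV"

definition Part :: "nat \<Rightarrow> index set set set" where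
  "Part p = {P. partition_on (indices p) P}"

definition Coh :: "nat \<Rightarrow> index set set set" where
  "Coh p = {P \<in> Part p. \<forall>C\<in>P. C \<subseteq> {..<p} \<times> {..<2} \<times> {0} \<or> C \<subseteq> {..<p} \<times> {..<2} \<times> {1}}"

definition CAs :: "nat \<Rightarrow> index set set \<Rightarrow> (index \<Rightarrow> nat) set" where
  "CAs p P = {\<tau> \<in> assignments p.
     \<forall>e s v e' s' v'. (e, s, v) \<in> indices p \<and> (e', s', v') \<in> indices p \<and> v = v' \<longrightarrow>
       (\<tau> (e, s, v) = \<tau> (e', s', v') \<longleftrightarrow> (\<exists>C\<in>P. (e, s, v) \<in> C \<and> (e', s', v') \<in> C))}"

definition CAs_eq :: "nat \<Rightarrow> index set set \<Rightarrow> (index \<Rightarrow> nat) set" where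
  "CAs_eq p P =
     {\<tau> \<in> CAs p P. \<forall>e<p. \<tau> (e, 0, 0) + \<tau> (e, 0, 1) = \<tau> (e, 1, 0) + \<tau> (e, 1, 1)}"

definition CAs_eq_len :: "nat \<Rightarrow> index set set \<Rightarrow> nat \<Rightarrow> (index \<Rightarrow> nat) set" where
  "CAs_eq_len p P l = {\<tau> \<in> CAs_eq p P. \<forall>i\<in>indices p. \<tau> i \<in> {..<l}}"

definition CSat :: "nat \<Rightarrow> index set set set" where
  "CSat p = {P \<in> Coh p. CAs_eq p P \<noteq> {}}"

definition even_partition :: "index set set \<Rightarrow> bool" where
  "even_partition P \<longleftrightarrow> (\<forall>C\<in>P. finite C \<and> even (card C))"

definition restrict_partition :: "index set set \<Rightarrow> nat \<Rightarrow> index set set" where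
  "restrict_partition P e = (\<lambda>C. C \<inter> ({e} \<times> {..<2} \<times> {..<2})) ` P - {{}}"

definition GELO :: "nat \<Rightarrow> index set set set" where
  "GELO p = {P \<in> Part p. even_partition P \<and>
     (\<forall>e<p. \<not> even_partition (restrict_partition P e))}"

definition CCon :: "nat \<Rightarrow> index set set set" where
  "CCon p = CSat p \<inter> GELO p"

end

theory Submission
  imports Defs
begin

text \<open>
  Expanding the squares, \<open>SSCC f g\<close> is the sum of the monomials
  \<open>f a * g d * f c * g b\<close> over all \<open>a + d = c + b\<close> below \<open>l\<close>, so the \<open>p\<close>th central moment is a
  sum over assignments \<open>\<tau>\<close> of expectations of products of \<open>p\<close> centred monomials. A monomial is
  identically \<open>1\<close> if every variable occurs an even number of times in it; otherwise flipping the
  sign of a variable of odd multiplicity shows that its mean is \<open>0\<close>. Hence \<open>\<tau>\<close> contributes \<open>0\<close> as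
  soon as one of its \<open>p\<close> monomials is even (that centred factor vanishes), and else it
  contributes \<open>1\<close> or \<open>0\<close> according to whether the product of all \<open>p\<close> monomials is even. Sorting
  the contributing \<open>\<tau>\<close> by their partition into level sets gives the claim.
\<close>

section \<open>Monomials in the entries of a pair of sequences\<close>

text \<open>Entries of binary sequences are real, so \<open>Re\<close> loses nothing and the
  computation can run in the reals. Side \<open>v = 0\<close> selects the first sequence, every
  other \<open>v\<close> the second.\<close>

definition entry :: "(int \<Rightarrow> complex) \<times> (int \<Rightarrow> complex) \<Rightarrow> nat \<Rightarrow> nat \<Rightarrow> real" where
  "entry x v n = Re ((if v = 0 then fst x else snd x) (int n))"

definition monomial :: "(index \<Rightarrow> nat) \<Rightarrow> index set \<Rightarrow> (int \<Rightarrow> complex) \<times> (int \<Rightarrow> complex) \<Rightarrow> real"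
  where "monomial \<tau> S x = (\<Prod>i\<in>S. entry x (snd (snd i)) (\<tau> i))"

text \<open>The pair \<open>(v, n)\<close> names one variable, entry \<open>n\<close> of sequence
  \<open>v\<close>. Its fibre lists its occurrences in the monomial over \<open>S\<close>, so the
  cardinality is its multiplicity.\<close>

definition fibre :: "(index \<Rightarrow> nat) \<Rightarrow> index set \<Rightarrow> nat \<Rightarrow> nat \<Rightarrow> index set" where
  "fibre \<tau> S v n = {i \<in> S. snd (snd i) = v \<and> \<tau> i = n}"

definition even_on :: "(index \<Rightarrow> nat) \<Rightarrow> index set \<Rightarrow> bool" where
  "even_on \<tau> S \<longleftrightarrow> (\<forall>v n. even (card (fibre \<tau> S v n)))"

definition block :: "nat \<Rightarrow> index set" where
  "block e = {e} \<times> {..<2} \<times> {..<2}"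

definition flip_entry :: "nat \<Rightarrow> nat \<Rightarrow> (int \<Rightarrow> complex) \<times> (int \<Rightarrow> complex)
    \<Rightarrow> (int \<Rightarrow> complex) \<times> (int \<Rightarrow> complex)" where
  "flip_entry v n x =
     (if v = 0 then ((fst x)(int n := - fst x (int n)), snd x)
      else (fst x, (snd x)(int n := - snd x (int n))))"

lemma finite_indices [simp]: "finite (indices p)"
  by (simp add: indices_def)

lemma finite_block [simp]: "finite (block e)"
  by (simp add: block_def)

lemma indices_eq_Union_block: "indices p = (\<Union>e<p. block e)"
  by (auto simp: indices_def block_def)

lemma block_subset_indices: "e < p \<Longrightarrow> block e \<subseteq> indices p"
  by (auto simp: indices_eq_Union_block)

lemma side_less_2: "i \<in> indices p \<Longrightarrow> snd (snd i) < 2"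
  by (auto simp: indices_def)

section \<open>The finite sample space and its averages\<close>

lemma finite_binary_seqs: "finite (binary_seqs l)"
proof (rule finite_subset)
  let ?F = "\<lambda>S j. if j \<in> {0..<int l} then if j \<in> S then 1 else -1 else (0::complex)"
  show "binary_seqs l \<subseteq> ?F ` Pow {0..<int l}"
  proof
    fix f assume f: "f \<in> binary_seqs l"
    have "f = ?F {j \<in> {0..<int l}. f j = 1}"
    proof
      fix j show "f j = ?F {j \<in> {0..<int l}. f j = 1} j"
        using f by (cases "j \<in> {0..<int l}") (auto simp: binary_seqs_def)
    qed
    then show "f \<in> ?F ` Pow {0..<int l}" by blast
  qed
qed simp

lemma finite_seq_pairs [simp]: "finite (seq_pairs l)"
  by (simp add: seq_pairs_def finite_binary_seqs)

lemma seq_pairs_nonempty [simp]: "seq_pairs l \<noteq> {}"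
proof -
  have "(\<lambda>j. if j \<in> {0..<int l} then 1 else 0) \<in> binary_seqs l"
    by (auto simp: binary_seqs_def)
  then show ?thesis by (auto simp: seq_pairs_def)
qed

lemma pair_expectation_eq:
  "pair_expectation l v = (\<Sum>x\<in>seq_pairs l. v x) / real (card (seq_pairs l))"
  unfolding pair_expectation_def by (rule integral_pmf_of_set) auto

lemma pair_expectation_cong:
  "(\<And>x. x \<in> seq_pairs l \<Longrightarrow> v x = w x) \<Longrightarrow> pair_expectation l v = pair_expectation l w"
  unfolding pair_expectation_eq by (metis sum.cong)

lemma pair_expectation_sum:
  "pair_expectation l (\<lambda>x. \<Sum>a\<in>A. v a x) = (\<Sum>a\<in>A. pair_expectation l (v a))"
  unfolding pair_expectation_eq by (subst sum.swap) (simp add: sum_divide_distrib)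

lemma pair_expectation_const [simp]: "pair_expectation l (\<lambda>x. c) = c"
  by (simp add: pair_expectation_eq)

section \<open>Even monomials and sign flips\<close>

lemma binary_seqs_cases: "f \<in> binary_seqs l \<Longrightarrow> n < l \<Longrightarrow> f (int n) = 1 \<or> f (int n) = -1"
  by (auto simp: binary_seqs_def)

lemma entry_sq: "x \<in> seq_pairs l \<Longrightarrow> n < l \<Longrightarrow> (entry x v n)\<^sup>2 = 1"
  using binary_seqs_cases[of "fst x" l n] binary_seqs_cases[of "snd x" l n]
  by (auto simp: seq_pairs_def entry_def)

text \<open>Grouping the factors by variable leaves even powers of entries that are 1 or -1.\<close>

lemma monomial_even:
  assumes "even_on \<tau> S" "x \<in> seq_pairs l" "finite S" "\<And>i. i \<in> S \<Longrightarrow> \<tau> i < l"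
  shows "monomial \<tau> S x = 1"
proof -
  let ?k = "\<lambda>i. (snd (snd i), \<tau> i)"
  have "monomial \<tau> S x = (\<Prod>q\<in>?k ` S. \<Prod>i\<in>{i \<in> S. ?k i = q}. entry x (snd (snd i)) (\<tau> i))"
    unfolding monomial_def by (rule prod.image_gen[OF assms(3)])
  also have "\<dots> = 1"
  proof (rule prod.neutral, rule ballI)
    fix q assume q: "q \<in> ?k ` S"
    obtain v n where vn: "q = (v, n)" by (cases q)
    have n: "n < l" using q vn assms(4) by auto
    have "{i \<in> S. ?k i = q} = fibre \<tau> S v n" by (auto simp: fibre_def vn)
    then have "(\<Prod>i\<in>{i \<in> S. ?k i = q}. entry x (snd (snd i)) (\<tau> i))
        = (\<Prod>i\<in>fibre \<tau> S v n. entry x v n)"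
      by (intro prod.cong) (auto simp: fibre_def)
    also have "\<dots> = entry x v n ^ card (fibre \<tau> S v n)" by simp
    also obtain m where m: "card (fibre \<tau> S v n) = 2 * m"
      using assms(1) by (meson even_on_def evenE)
    have "entry x v n ^ card (fibre \<tau> S v n) = 1"
      using entry_sq[OF assms(2) n] by (simp add: m power_mult)
    finally show "(\<Prod>i\<in>{i \<in> S. ?k i = q}. entry x (snd (snd i)) (\<tau> i)) = 1" .
  qed
  finally show ?thesis .
qed

lemma flip_entry_flip_entry [simp]: "flip_entry v n (flip_entry v n x) = x"
  by (cases x) (simp add: flip_entry_def)

lemma flip_entry_in_seq_pairs:
  "x \<in> seq_pairs l \<Longrightarrow> n < l \<Longrightarrow> flip_entry v n x \<in> seq_pairs l"
  using binary_seqs_cases[of "fst x" l n] binary_seqs_cases[of "snd x" l n]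
  by (cases x) (auto simp: flip_entry_def seq_pairs_def binary_seqs_def)

lemma entry_flip_entry:
  "v < 2 \<Longrightarrow> v' < 2 \<Longrightarrow>
    entry (flip_entry v n x) v' n' = (if v' = v \<and> n' = n then -1 else 1) * entry x v' n'"
  by (auto simp: entry_def flip_entry_def)

text \<open>Each occurrence of the flipped variable contributes one factor -1.\<close>

lemma monomial_flip_entry:
  assumes "finite S" "\<And>i. i \<in> S \<Longrightarrow> snd (snd i) < 2" "v < 2"
  shows "monomial \<tau> S (flip_entry v n x) = (-1) ^ card (fibre \<tau> S v n) * monomial \<tau> S x"
proof -
  have "monomial \<tau> S (flip_entry v n x)
      = (\<Prod>i\<in>S. (if snd (snd i) = v \<and> \<tau> i = n then -1 else 1) * entry x (snd (snd i)) (\<tau> i))"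
    unfolding monomial_def using assms by (intro prod.cong) (simp_all add: entry_flip_entry)
  also have "\<dots> = (\<Prod>i\<in>S. if snd (snd i) = v \<and> \<tau> i = n then -1 else 1) * monomial \<tau> S x"
    by (simp add: prod.distrib monomial_def)
  also have "(\<Prod>i\<in>S. if snd (snd i) = v \<and> \<tau> i = n then -1 else (1::real))
      = (\<Prod>i\<in>fibre \<tau> S v n. -1)"
    unfolding fibre_def using assms(1) by (simp add: prod.If_cases Int_def)
  also have "\<dots> = (-1) ^ card (fibre \<tau> S v n)" by simp
  finally show ?thesis .
qed

text \<open>In the odd case, the flip is an involution of the sample space that negates the
  monomial, so the sum over all pairs equals its own negative.\<close>

lemma expectation_monomial:
  assumes "finite S" "\<And>i. i \<in> S \<Longrightarrow> snd (snd i) < 2" "\<And>i. i \<in> S \<Longrightarrow> \<tau> i < l"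
  shows "pair_expectation l (monomial \<tau> S) = of_bool (even_on \<tau> S)"
proof (cases "even_on \<tau> S")
  case True
  then have "pair_expectation l (monomial \<tau> S) = pair_expectation l (\<lambda>x. 1)"
    using assms by (intro pair_expectation_cong) (simp add: monomial_even)
  with True show ?thesis by simp
next
  case False
  then obtain v n where odd: "odd (card (fibre \<tau> S v n))" by (auto simp: even_on_def)
  \<comment> \<open>An odd multiplicity forces an occurrence, which supplies the bounds on
    \<open>v\<close> and \<open>n\<close> that the flip lemmas demand.\<close>
  then have "fibre \<tau> S v n \<noteq> {}" by (metis card.empty even_zero)
  then have vn: "v < 2" "n < l" using assms by (auto simp: fibre_def)
  have "(\<Sum>x\<in>seq_pairs l. monomial \<tau> S x)
      = (\<Sum>x\<in>seq_pairs l. monomial \<tau> S (flip_entry v n x))"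
    by (rule sum.reindex_bij_witness[of _ "flip_entry v n" "flip_entry v n"])
       (auto simp: flip_entry_in_seq_pairs vn)
  also have "\<dots> = - (\<Sum>x\<in>seq_pairs l. monomial \<tau> S x)"
    using odd assms vn by (simp add: monomial_flip_entry sum_negf)
  finally show ?thesis using False by (simp add: pair_expectation_eq)
qed

section \<open>Expansion of the central moment\<close>

text \<open>The condition is \<open>a - b = c - d\<close>, equality of two shifts, written without
  subtraction of naturals. The order \<open>(a, d, c, b)\<close> matches the slots (0,0), (0,1),
  (1,0), (1,1) of an assignment.\<close>

definition quads :: "nat \<Rightarrow> (nat \<times> nat \<times> nat \<times> nat) set" where
  "quads l = {(a, d, c, b). a < l \<and> d < l \<and> c < l \<and> b < l \<and> a + d = c + b}"

definition quad_monomial :: "nat \<times> nat \<times> nat \<times> nat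
    \<Rightarrow> (int \<Rightarrow> complex) \<times> (int \<Rightarrow> complex) \<Rightarrow> real" where
  "quad_monomial = (\<lambda>(a, d, c, b) x. entry x 0 a * entry x 1 d * entry x 0 c * entry x 1 b)"

definition quad_of :: "(index \<Rightarrow> nat) \<Rightarrow> nat \<Rightarrow> nat \<times> nat \<times> nat \<times> nat" where
  "quad_of \<tau> e = (\<tau> (e, 0, 0), \<tau> (e, 0, 1), \<tau> (e, 1, 0), \<tau> (e, 1, 1))"

text \<open>The assignments counted by the sets \<open>CAs_eq_len p P l\<close> for all coherent
  \<open>P\<close> together, before any sorting by partition.\<close>

definition bounded_assignments :: "nat \<Rightarrow> nat \<Rightarrow> (index \<Rightarrow> nat) set" where
  "bounded_assignments p l = {\<tau> \<in> indices p \<rightarrow>\<^sub>E {..<l}.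
     \<forall>e<p. \<tau> (e, 0, 0) + \<tau> (e, 0, 1) = \<tau> (e, 1, 0) + \<tau> (e, 1, 1)}"

lemma finite_quads [simp]: "finite (quads l)"
  by (rule finite_subset[of _ "{..<l} \<times> {..<l} \<times> {..<l} \<times> {..<l}"]) (auto simp: quads_def)

lemma finite_bounded_assignments [simp]: "finite (bounded_assignments p l)"
  by (rule finite_subset[of _ "indices p \<rightarrow>\<^sub>E {..<l}"])
     (auto simp: bounded_assignments_def finite_PiE)

lemma block_eq: "block e = {(e, 0, 0), (e, 0, 1), (e, 1, 0), (e, 1, 1)}"
  by (auto simp: block_def less_2_cases_iff)

lemma mem_indices_iff: "(e, s, v) \<in> indices p \<longleftrightarrow> e < p \<and> s < 2 \<and> v < 2"
  by (simp add: indices_def)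

lemma monomial_block: "monomial \<tau> (block e) = quad_monomial (quad_of \<tau> e)"
  by (rule ext) (simp add: monomial_def block_eq quad_monomial_def quad_of_def)

lemma monomial_indices: "monomial \<tau> (indices p) x = (\<Prod>e<p. monomial \<tau> (block e) x)"
  unfolding monomial_def indices_eq_Union_block
  by (rule prod.UNION_disjoint) (auto simp: block_def)

section \<open>\<open>SSCC\<close> as a sum of monomials\<close>

lemma binary_seqs_eq_of_real:
  assumes "f \<in> binary_seqs l"
  shows "f j = complex_of_real (Re (f j))"
proof (cases "j \<in> {0..<int l}")
  case True
  with assms have "f j = 1 \<or> f j = -1" by (auto simp: binary_seqs_def)
  then show ?thesis by auto
next
  case False
  with assms have "f j = 0" by (auto simp: binary_seqs_def)
  then show ?thesis by simp
qed

lemma binary_seqs_eq_0: "f \<in> binary_seqs l \<Longrightarrow> j \<notin> {0..<int l} \<Longrightarrow> f j = 0"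
  by (auto simp: binary_seqs_def)

text \<open>The shift is moved into an indicator over a range independent of \<open>s\<close>, so
  that sums over \<open>s\<close> can later be interchanged with it.\<close>

lemma crosscorr_eq:
  assumes "f \<in> binary_seqs l" "g \<in> binary_seqs l"
  shows "crosscorr f g s = complex_of_real
    (\<Sum>(a, b)\<in>{..<l} \<times> {..<l}. of_bool (int a - int b = s) * (Re (f (int a)) * Re (g (int b))))"
proof -
  \<comment> \<open>Only \<open>a = b + s\<close> survives. If that index is out of range, both
    sides vanish because \<open>f\<close> is 0 there.\<close>
  have inner: "(\<Sum>a<l. of_bool (int a - int b = s) * (Re (f (int a)) * Re (g (int b))))
      = Re (f (int b + s)) * Re (g (int b))" for b
  proof (cases "int b + s \<in> {0..<int l}")
    case True
    have "(\<Sum>a<l. of_bool (int a - int b = s) * (Re (f (int a)) * Re (g (int b))))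
      = (\<Sum>a<l. if a = nat (int b + s) then Re (f (int a)) * Re (g (int b)) else 0)"
      using True by (intro sum.cong) auto
    also have "\<dots> = Re (f (int b + s)) * Re (g (int b))"
      using True by (auto simp: sum.delta)
    finally show ?thesis .
  next
    case False
    then have "(\<Sum>a<l. of_bool (int a - int b = s) * (Re (f (int a)) * Re (g (int b)))) = 0"
      by (intro sum.neutral) auto
    then show ?thesis using binary_seqs_eq_0[OF assms(1) False] by simp
  qed
  have "crosscorr f g s = (\<Sum>\<^sub>\<infinity>j\<in>{0..<int l}. f (j + s) * cnj (g j))"
    unfolding crosscorr_def
    by (rule infsum_cong_neutral) (auto simp: binary_seqs_eq_0[OF assms(2)])
  also have "\<dots> = (\<Sum>j\<in>{0..<int l}. f (j + s) * cnj (g j))" by simp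
  also have "\<dots> = (\<Sum>b<l. f (int b + s) * cnj (g (int b)))"
    by (rule sum.reindex_bij_witness[of _ int nat]) auto
  also have "\<dots> = complex_of_real (\<Sum>b<l. Re (f (int b + s)) * Re (g (int b)))"
  proof -
    have "f (int b + s) * cnj (g (int b)) = complex_of_real (Re (f (int b + s)) * Re (g (int b)))"
      for b
      using binary_seqs_eq_of_real[OF assms(1), of "int b + s"]
        binary_seqs_eq_of_real[OF assms(2), of "int b"]
      by (metis complex_cnj_complex_of_real of_real_mult)
    then show ?thesis by simp
  qed
  also have "(\<Sum>b<l. Re (f (int b + s)) * Re (g (int b))) =
    (\<Sum>(a, b)\<in>{..<l} \<times> {..<l}. of_bool (int a - int b = s) * (Re (f (int a)) * Re (g (int b))))"
    unfolding inner[symmetric] by (subst sum.swap) (simp only: sum.cartesian_product)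
  finally show ?thesis .
qed

text \<open>Squaring yields a double sum over index pairs \<open>u = (a, b)\<close> and
  \<open>w = (c, d)\<close>, both of difference \<open>s\<close>; summing over \<open>s\<close>
  leaves the condition that the two differences agree.\<close>

lemma SSCC_eq_sum_quads:
  assumes "(f, g) \<in> seq_pairs l"
  shows "SSCC f g = (\<Sum>q\<in>quads l. quad_monomial q (f, g))"
proof -
  have fg: "f \<in> binary_seqs l" "g \<in> binary_seqs l" using assms by (auto simp: seq_pairs_def)
  \<comment> \<open>The window \<open>?I\<close> contains every difference of two indices below
    \<open>l\<close>, hence every shift with nonzero correlation.\<close>
  let ?L = "{..<l} \<times> {..<l}" and ?I = "{- int l..int l}"
  define t where "t = (\<lambda>(a, b). Re (f (int a)) * Re (g (int b)))"
  define d where "d = (\<lambda>(a, b). int a - int b)"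
  have sq: "(cmod (crosscorr f g s))\<^sup>2
      = (\<Sum>u\<in>?L. \<Sum>w\<in>?L. of_bool (d u = s \<and> d w = s) * (t u * t w))" for s
  proof -
    have "crosscorr f g s = complex_of_real (\<Sum>u\<in>?L. of_bool (d u = s) * t u)"
      unfolding crosscorr_eq[OF fg] t_def d_def by (simp add: case_prod_unfold)
    then have "(cmod (crosscorr f g s))\<^sup>2 = (\<Sum>u\<in>?L. of_bool (d u = s) * t u)\<^sup>2"
      by (simp only: norm_of_real power2_abs)
    also have "\<dots> = (\<Sum>u\<in>?L. \<Sum>w\<in>?L. of_bool (d u = s \<and> d w = s) * (t u * t w))"
      unfolding power2_eq_square sum_product by (intro sum.cong) auto
    finally show ?thesis .
  qed
  have d_in: "d u \<in> ?I" if "u \<in> ?L" for u using that by (auto simp: d_def)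
  have "SSCC f g = (\<Sum>\<^sub>\<infinity>s\<in>?I. (cmod (crosscorr f g s))\<^sup>2)"
    unfolding SSCC_def
  proof (rule infsum_cong_neutral)
    fix s assume "s \<in> UNIV - ?I"
    then have "d u \<noteq> s" if "u \<in> ?L" for u using d_in[OF that] by blast
    then show "(cmod (crosscorr f g s))\<^sup>2 = 0"
      unfolding sq by (intro sum.neutral ballI) auto
  qed auto
  also have "\<dots> = (\<Sum>s\<in>?I. \<Sum>u\<in>?L. \<Sum>w\<in>?L. of_bool (d u = s \<and> d w = s) * (t u * t w))"
    by (simp add: sq)
  also have "\<dots> = (\<Sum>u\<in>?L. \<Sum>w\<in>?L. \<Sum>s\<in>?I. of_bool (d u = s \<and> d w = s) * (t u * t w))"
    by (subst sum.swap, rule sum.cong[OF refl], rule sum.swap)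
  also have "\<dots> = (\<Sum>u\<in>?L. \<Sum>w\<in>?L. if d u = d w then t u * t w else 0)"
  proof (intro sum.cong refl)
    fix u w assume u: "u \<in> ?L"
    have "(\<Sum>s\<in>?I. of_bool (d u = s \<and> d w = s) * (t u * t w))
        = (\<Sum>s\<in>?I. if s = d u then of_bool (d u = d w) * (t u * t w) else 0)"
      by (intro sum.cong) auto
    \<comment> \<open>Membership in the window is kept folded so that \<open>d_in\<close> can
      discharge it.\<close>
    also have "\<dots> = (if d u = d w then t u * t w else 0)"
      by (simp add: sum.delta d_in[OF u] del: atLeastAtMost_iff)
    finally show "(\<Sum>s\<in>?I. of_bool (d u = s \<and> d w = s) * (t u * t w))
        = (if d u = d w then t u * t w else 0)" .
  qed
  also have "\<dots> = (\<Sum>(u, w)\<in>?L \<times> ?L. if d u = d w then t u * t w else 0)"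
    by (simp add: sum.cartesian_product)
  also have "\<dots> = (\<Sum>(u, w)\<in>{(u, w). u \<in> ?L \<and> w \<in> ?L \<and> d u = d w}. t u * t w)"
    by (rule sum.mono_neutral_cong_right) (auto split: if_splits)
  \<comment> \<open>The indices of \<open>g\<close> trade places here: \<open>b\<close> belongs to
    the first pair but goes last, which turns \<open>a - b = c - d\<close> into
    \<open>a + d = c + b\<close>.\<close>
  also have "\<dots> = (\<Sum>q\<in>quads l. quad_monomial q (f, g))"
    by (rule sum.reindex_bij_witness[of _ "\<lambda>(a, d, c, b). ((a, b), (c, d))"
          "\<lambda>((a, b), (c, d)). (a, d, c, b)"])
       (auto simp: quads_def quad_monomial_def d_def t_def entry_def)
  finally show ?thesis .
qed

section \<open>Products of centred monomials\<close>

lemma quad_of_in_quads: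
  "\<tau> \<in> bounded_assignments p l \<Longrightarrow> e < p \<Longrightarrow> quad_of \<tau> e \<in> quads l"
  by (auto simp: bounded_assignments_def quad_of_def quads_def mem_indices_iff PiE_iff)

text \<open>Choosing one quadruple for each \<open>e < p\<close> amounts to choosing one assignment,
  via \<open>quad_of\<close>.\<close>

lemma sum_PiE_quads:
  "(\<Sum>h\<in>{..<p} \<rightarrow>\<^sub>E quads l. \<Prod>e<p. F (h e))
    = (\<Sum>\<tau>\<in>bounded_assignments p l. \<Prod>e<p. F (quad_of \<tau> e))"
proof -
  \<comment> \<open>The inverse of \<open>quad_of\<close>, taken for all \<open>e\<close> at once;
    restricting it to \<open>indices p\<close> keeps it extensional.\<close>
  define unquad where "unquad = (\<lambda>h :: nat \<Rightarrow> nat \<times> nat \<times> nat \<times> nat.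
    \<lambda>i\<in>indices p. case i of (e, s, v) \<Rightarrow> case h e of (a, d, c, b) \<Rightarrow>
      if s = 0 then if v = 0 then a else d else if v = 0 then c else b)"
  have quad_unquad: "quad_of (unquad h) e = h e" if "e < p" for h e
    using that by (auto simp: unquad_def quad_of_def mem_indices_iff split: prod.splits)
  show ?thesis
  proof (rule sum.reindex_bij_witness[of _ "\<lambda>\<tau>. \<lambda>e\<in>{..<p}. quad_of \<tau> e" unquad])
    fix h assume h: "h \<in> {..<p} \<rightarrow>\<^sub>E quads l"
    show "(\<lambda>e\<in>{..<p}. quad_of (unquad h) e) = h"
      using h by (intro ext) (auto simp: quad_unquad PiE_iff extensional_def)
    have q: "h e \<in> quads l" if "e < p" for e using h that by auto
    have "unquad h i < l" if "i \<in> indices p" for i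
      using that q[of "fst i"]
      by (auto simp: unquad_def quads_def indices_def split: prod.splits)
    moreover have "unquad h (e, 0, 0) + unquad h (e, 0, 1)
        = unquad h (e, 1, 0) + unquad h (e, 1, 1)" if "e < p" for e
      using q[OF that] quad_unquad[OF that, of h] by (auto simp: quad_of_def quads_def)
    ultimately show "unquad h \<in> bounded_assignments p l"
      by (auto simp: bounded_assignments_def PiE_iff) (simp add: unquad_def)
    show "(\<Prod>e<p. F (quad_of (unquad h) e)) = (\<Prod>e<p. F (h e))"
      by (simp add: quad_unquad)
  next
    fix \<tau> assume \<tau>: "\<tau> \<in> bounded_assignments p l"
    show "unquad (\<lambda>e\<in>{..<p}. quad_of \<tau> e) = \<tau>"
    proof
      fix i show "unquad (\<lambda>e\<in>{..<p}. quad_of \<tau> e) i = \<tau> i"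
      proof (cases "i \<in> indices p")
        case True
        then show ?thesis
          by (auto simp: unquad_def quad_of_def indices_def less_2_cases_iff split: prod.splits)
      next
        case False
        then show ?thesis
          using \<tau> by (cases i) (simp add: unquad_def bounded_assignments_def PiE_iff extensional_def)
      qed
    qed
    show "(\<lambda>e\<in>{..<p}. quad_of \<tau> e) \<in> {..<p} \<rightarrow>\<^sub>E quads l"
      using \<tau> by (auto simp: quad_of_in_quads)
  qed
qed

text \<open>If no block is even, all means are 0 and the product is the monomial over all of
  \<open>indices p\<close>. An even block gives the factor 1 - 1.\<close>

lemma expectation_prod_centred:
  assumes "\<tau> \<in> bounded_assignments p l"
  shows "pair_expectation l
      (\<lambda>x. \<Prod>e<p. quad_monomial (quad_of \<tau> e) x - pair_expectation l (quad_monomial (quad_of \<tau> e)))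
    = of_bool (even_on \<tau> (indices p) \<and> (\<forall>e<p. \<not> even_on \<tau> (block e)))"
proof -
  have bound: "\<tau> i < l" if "i \<in> indices p" for i
    using assms that by (auto simp: bounded_assignments_def)
  have mean: "pair_expectation l (monomial \<tau> (block e)) = of_bool (even_on \<tau> (block e))"
    if "e < p" for e
    using block_subset_indices[OF that] bound by (intro expectation_monomial) (auto intro: side_less_2)
  have "pair_expectation l
      (\<lambda>x. \<Prod>e<p. quad_monomial (quad_of \<tau> e) x - pair_expectation l (quad_monomial (quad_of \<tau> e)))
    = pair_expectation l (\<lambda>x. \<Prod>e<p. monomial \<tau> (block e) x - of_bool (even_on \<tau> (block e)))"
    by (simp add: mean flip: monomial_block)
  also have "\<dots> = of_bool (even_on \<tau> (indices p) \<and> (\<forall>e<p. \<not> even_on \<tau> (block e)))"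
  proof (cases "\<forall>e<p. \<not> even_on \<tau> (block e)")
    case True
    then have "pair_expectation l (\<lambda>x. \<Prod>e<p. monomial \<tau> (block e) x - of_bool (even_on \<tau> (block e)))
        = pair_expectation l (monomial \<tau> (indices p))"
      by (intro pair_expectation_cong) (simp add: monomial_indices)
    also have "\<dots> = of_bool (even_on \<tau> (indices p))"
      using bound by (intro expectation_monomial) (auto intro: side_less_2)
    finally show ?thesis using True by simp
  next
    case False
    then obtain e where e: "e < p" "even_on \<tau> (block e)" by blast
    have "pair_expectation l (\<lambda>x. \<Prod>e<p. monomial \<tau> (block e) x - of_bool (even_on \<tau> (block e)))
        = pair_expectation l (\<lambda>x. 0)"
    proof (rule pair_expectation_cong)
      fix x assume "x \<in> seq_pairs l"
      then have "monomial \<tau> (block e) x = 1"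
        using e block_subset_indices[OF e(1)] bound by (intro monomial_even[of _ _ _ l]) auto
      with e show "(\<Prod>e<p. monomial \<tau> (block e) x - of_bool (even_on \<tau> (block e))) = 0"
        by (intro prod_zero) auto
    qed
    with False show ?thesis by simp
  qed
  finally show ?thesis .
qed

text \<open>The power is a product of \<open>p\<close> equal sums; distributing it picks one
  quadruple per factor.\<close>

lemma central_moment_eq_card:
  "pair_central_moment p l (\<lambda>(f, g). SSCC f g)
    = real (card {\<tau> \<in> bounded_assignments p l.
        even_on \<tau> (indices p) \<and> (\<forall>e<p. \<not> even_on \<tau> (block e))})"
proof -
  let ?E = "pair_expectation l"
  let ?c = "\<lambda>q x. quad_monomial q x - ?E (quad_monomial q)"
  have SSCC: "(\<lambda>(f, g). SSCC f g) x = (\<Sum>q\<in>quads l. quad_monomial q x)" if "x \<in> seq_pairs l" for x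
    using that SSCC_eq_sum_quads by (cases x) auto
  have mean: "?E (\<lambda>(f, g). SSCC f g) = (\<Sum>q\<in>quads l. ?E (quad_monomial q))"
    by (subst pair_expectation_cong[OF SSCC]) (auto simp: pair_expectation_sum)
  have "pair_central_moment p l (\<lambda>(f, g). SSCC f g)
      = ?E (\<lambda>x. \<Sum>\<tau>\<in>bounded_assignments p l. \<Prod>e<p. ?c (quad_of \<tau> e) x)"
    unfolding pair_central_moment_def
  proof (rule pair_expectation_cong)
    fix x assume x: "x \<in> seq_pairs l"
    \<comment> \<open>Centring is termwise: by linearity each monomial loses its own mean.\<close>
    have "((\<lambda>(f, g). SSCC f g) x - ?E (\<lambda>(f, g). SSCC f g)) ^ p = (\<Prod>e<p. \<Sum>q\<in>quads l. ?c q x)"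
      by (simp add: SSCC[OF x] mean sum_subtractf)
    also have "\<dots> = (\<Sum>h\<in>{..<p} \<rightarrow>\<^sub>E quads l. \<Prod>e<p. ?c (h e) x)"
      by (rule prod_sum_PiE) auto
    also have "\<dots> = (\<Sum>\<tau>\<in>bounded_assignments p l. \<Prod>e<p. ?c (quad_of \<tau> e) x)"
      by (rule sum_PiE_quads)
    finally show "((\<lambda>(f, g). SSCC f g) x - ?E (\<lambda>(f, g). SSCC f g)) ^ p
        = (\<Sum>\<tau>\<in>bounded_assignments p l. \<Prod>e<p. ?c (quad_of \<tau> e) x)" .
  qed
  also have "\<dots> = (\<Sum>\<tau>\<in>bounded_assignments p l.
      of_bool (even_on \<tau> (indices p) \<and> (\<forall>e<p. \<not> even_on \<tau> (block e))))"
    unfolding pair_expectation_sum by (intro sum.cong refl expectation_prod_centred)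
  also have "\<dots> = real (card {\<tau> \<in> bounded_assignments p l.
        even_on \<tau> (indices p) \<and> (\<forall>e<p. \<not> even_on \<tau> (block e))})"
    by (simp add: of_bool_def sum.If_cases Int_def)
  finally show ?thesis .
qed

section \<open>Sorting assignments by their partitions\<close>

text \<open>Level sets taken separately on each side, hence coherent. As an image over
  \<open>indices p\<close> it has only nonempty classes.\<close>

definition fibre_partition :: "nat \<Rightarrow> (index \<Rightarrow> nat) \<Rightarrow> index set set" where
  "fibre_partition p \<tau> = (\<lambda>i. fibre \<tau> (indices p) (snd (snd i)) (\<tau> i)) ` indices p"

lemma fibre_partition_in_Coh: "fibre_partition p \<tau> \<in> Coh p"
proof -
  have "partition_on (indices p) (fibre_partition p \<tau>)"
    by (rule partition_onI) (auto simp: fibre_partition_def fibre_def disjnt_iff)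
  moreover have "C \<subseteq> {..<p} \<times> {..<2} \<times> {0} \<or> C \<subseteq> {..<p} \<times> {..<2} \<times> {1}"
    if C: "C \<in> fibre_partition p \<tau>" for C
  proof -
    obtain i where "i \<in> indices p" "C = fibre \<tau> (indices p) (snd (snd i)) (\<tau> i)"
      using C unfolding fibre_partition_def by blast
    then obtain v n where "C = fibre \<tau> (indices p) v n" "v < 2"
      using side_less_2 by blast
    moreover have "fibre \<tau> (indices p) v n \<subseteq> {..<p} \<times> {..<2} \<times> {v}"
      by (auto simp: fibre_def indices_def)
    ultimately show ?thesis using less_2_cases[of v] by auto
  qed
  ultimately show ?thesis by (simp add: Coh_def Part_def)
qed

lemma in_CAs_fibre_partition:
  assumes "\<tau> \<in> assignments p"
  shows "\<tau> \<in> CAs p (fibre_partition p \<tau>)"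
proof -
  have "\<tau> i = \<tau> j \<longleftrightarrow> (\<exists>C\<in>fibre_partition p \<tau>. i \<in> C \<and> j \<in> C)"
    if "i \<in> indices p" "j \<in> indices p" "snd (snd i) = snd (snd j)" for i j
    using that by (auto simp: fibre_partition_def fibre_def)
  with assms show ?thesis by (simp add: CAs_def)
qed

text \<open>On each side, \<open>\<tau>\<close> decides which indices share a class, and coherence
  forbids classes that mix sides; so \<open>\<tau>\<close> determines \<open>P\<close>.\<close>

lemma CAs_eq_fibre_partition:
  assumes P: "P \<in> Coh p" and \<tau>: "\<tau> \<in> CAs p P"
  shows "P = fibre_partition p \<tau>"
proof -
  have part: "partition_on (indices p) P" using P by (simp add: Coh_def Part_def)
  \<comment> \<open>Every class is the fibre through any of its members.\<close>
  have cls: "C = fibre \<tau> (indices p) (snd (snd i)) (\<tau> i)" if C: "C \<in> P" and i: "i \<in> C" for C i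
  proof -
    have same: "\<tau> j = \<tau> k \<longleftrightarrow> (\<exists>D\<in>P. j \<in> D \<and> k \<in> D)"
      if "j \<in> indices p" "k \<in> indices p" "snd (snd j) = snd (snd k)" for j k
      using \<tau> that by (cases j, cases k) (auto simp: CAs_def)
    have C_sub: "C \<subseteq> indices p" using part C by (auto simp: partition_on_def)
    \<comment> \<open>Coherence enters here, since \<open>CAs\<close> compares only indices of the
      same side.\<close>
    have side: "snd (snd j) = snd (snd i)" if "j \<in> C" for j
    proof -
      have "C \<subseteq> {..<p} \<times> {..<2} \<times> {0} \<or> C \<subseteq> {..<p} \<times> {..<2} \<times> {1}"
        using P C by (auto simp: Coh_def)
      then show ?thesis using that i by (cases i; cases j) auto
    qed
    show ?thesis
    proof
      show "C \<subseteq> fibre \<tau> (indices p) (snd (snd i)) (\<tau> i)"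
      proof
        fix j assume j: "j \<in> C"
        then show "j \<in> fibre \<tau> (indices p) (snd (snd i)) (\<tau> i)"
          using same[of j i] side[OF j] C_sub C i by (auto simp: fibre_def)
      qed
      show "fibre \<tau> (indices p) (snd (snd i)) (\<tau> i) \<subseteq> C"
      proof
        fix j assume "j \<in> fibre \<tau> (indices p) (snd (snd i)) (\<tau> i)"
        then have "\<exists>D\<in>P. j \<in> D \<and> i \<in> D"
          using same[of j i] C_sub i by (auto simp: fibre_def)
        \<comment> \<open>Both \<open>C\<close> and \<open>D\<close> contain \<open>i\<close>, so
          disjointness of classes makes them equal.\<close>
        then show "j \<in> C" using part C i by (auto simp: partition_on_def disjoint_def)
      qed
    qed
  qed
  show ?thesis
  proof
    show "P \<subseteq> fibre_partition p \<tau>"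
    proof
      fix C assume C: "C \<in> P"
      then have "C \<noteq> {}" "C \<subseteq> indices p" using part by (auto simp: partition_on_def)
      then obtain i where i: "i \<in> C" "i \<in> indices p" by blast
      show "C \<in> fibre_partition p \<tau>"
        unfolding fibre_partition_def using cls[OF C i(1)] i(2) by (rule image_eqI)
    qed
    show "fibre_partition p \<tau> \<subseteq> P"
    proof
      fix C assume "C \<in> fibre_partition p \<tau>"
      then obtain i where i: "i \<in> indices p" "C = fibre \<tau> (indices p) (snd (snd i)) (\<tau> i)"
        by (auto simp: fibre_partition_def)
      then obtain D where D: "D \<in> P" "i \<in> D" using part by (auto simp: partition_on_def)
      then show "C \<in> P" using cls[OF D] i(2) by simp
    qed
  qed
qed

section \<open>Parity of partitions and of fibres\<close>

lemma even_on_iff_nonempty_fibres: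
  "even_on \<tau> S \<longleftrightarrow> (\<forall>i\<in>S. even (card (fibre \<tau> S (snd (snd i)) (\<tau> i))))"
proof
  assume *: "\<forall>i\<in>S. even (card (fibre \<tau> S (snd (snd i)) (\<tau> i)))"
  have "even (card (fibre \<tau> S v n))" for v n
  proof (cases "fibre \<tau> S v n = {}")
    case False
    then obtain i where "i \<in> S" "snd (snd i) = v" "\<tau> i = n" by (auto simp: fibre_def)
    with * show ?thesis by auto
  qed simp
  then show "even_on \<tau> S" by (simp add: even_on_def)
qed (simp add: even_on_def)

lemma finite_fibre: "finite S \<Longrightarrow> finite (fibre \<tau> S v n)"
  by (simp add: fibre_def)

lemma even_fibre_partition:
  "even_partition (fibre_partition p \<tau>) \<longleftrightarrow> even_on \<tau> (indices p)"
  unfolding even_on_iff_nonempty_fibres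
  by (auto simp: even_partition_def fibre_partition_def finite_fibre)

lemma even_partition_Diff_empty: "even_partition (P - {{}}) \<longleftrightarrow> even_partition P"
  by (auto simp: even_partition_def)

text \<open>Cutting a fibre down to block \<open>e\<close> gives the fibre of \<open>\<tau>\<close>
  inside that block; discarding empty classes leaves parity unchanged.\<close>

lemma even_restrict_fibre_partition:
  assumes "e < p"
  shows "even_partition (restrict_partition (fibre_partition p \<tau>) e) \<longleftrightarrow> even_on \<tau> (block e)"
proof -
  have restr: "fibre \<tau> (indices p) v n \<inter> block e = fibre \<tau> (block e) v n" for v n
    using block_subset_indices[OF assms] by (auto simp: fibre_def)
  have "restrict_partition (fibre_partition p \<tau>) e
      = (\<lambda>i. fibre \<tau> (block e) (snd (snd i)) (\<tau> i)) ` indices p - {{}}"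
    by (simp add: restrict_partition_def fibre_partition_def image_image restr flip: block_def)
  then have "even_partition (restrict_partition (fibre_partition p \<tau>) e) \<longleftrightarrow>
      (\<forall>i\<in>indices p. even (card (fibre \<tau> (block e) (snd (snd i)) (\<tau> i))))"
    by (simp add: even_partition_Diff_empty) (simp add: even_partition_def finite_fibre)
  \<comment> \<open>Here \<open>i\<close> runs over all indices. Those in the block already suffice
    for \<open>even_on\<close>, and conversely \<open>even_on\<close> covers every pair of side and
    value.\<close>
  also have "\<dots> \<longleftrightarrow> even_on \<tau> (block e)"
    using block_subset_indices[OF assms] even_on_iff_nonempty_fibres[of \<tau> "block e"]
      even_on_def[of \<tau> "block e"] by blast
  finally show ?thesis .
qed

lemma fibre_partition_in_GELO_iff:
  "fibre_partition p \<tau> \<in> GELO p \<longleftrightarrow>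
    even_on \<tau> (indices p) \<and> (\<forall>e<p. \<not> even_on \<tau> (block e))"
  using fibre_partition_in_Coh[of p \<tau>]
  by (auto simp: GELO_def Coh_def even_fibre_partition even_restrict_fibre_partition)

text \<open>This makes the sets \<open>CAs_eq_len p P l\<close> the preimages of coherent partitions
  under \<open>fibre_partition p\<close>, so their disjointness is immediate.\<close>

lemma CAs_eq_len_iff:
  assumes "P \<in> Coh p"
  shows "\<tau> \<in> CAs_eq_len p P l \<longleftrightarrow> \<tau> \<in> bounded_assignments p l \<and> P = fibre_partition p \<tau>"
proof
  assume \<tau>: "\<tau> \<in> CAs_eq_len p P l"
  then have "\<tau> \<in> CAs p P" by (simp add: CAs_eq_len_def CAs_eq_def)
  moreover have "\<tau> \<in> bounded_assignments p l"
    using \<tau> by (auto simp: CAs_eq_len_def CAs_eq_def CAs_def assignments_def bounded_assignments_def)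
  ultimately show "\<tau> \<in> bounded_assignments p l \<and> P = fibre_partition p \<tau>"
    using CAs_eq_fibre_partition[OF assms] by blast
next
  assume \<tau>: "\<tau> \<in> bounded_assignments p l \<and> P = fibre_partition p \<tau>"
  then have "\<tau> \<in> assignments p"
    by (auto simp: bounded_assignments_def assignments_def)
  then have "\<tau> \<in> CAs p P" using \<tau> in_CAs_fibre_partition by blast
  with \<tau> show "\<tau> \<in> CAs_eq_len p P l"
    by (auto simp: CAs_eq_len_def CAs_eq_def bounded_assignments_def PiE_iff)
qed

theorem proposition3p1:
  fixes p l :: nat
  shows "pair_central_moment p l (\<lambda>(f, g). SSCC f g)
    = (\<Sum>P\<in>CCon p. real (card (CAs_eq_len p P l)))"
proof -
  have coh: "P \<in> Coh p" if "P \<in> CCon p" for P using that by (simp add: CCon_def CSat_def)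
  have "CCon p \<subseteq> Pow (Pow (indices p))"
    by (auto simp: CCon_def GELO_def Part_def partition_on_def)
  then have fin: "finite (CCon p)" by (rule finite_subset) simp
  have "{\<tau> \<in> bounded_assignments p l. even_on \<tau> (indices p) \<and> (\<forall>e<p. \<not> even_on \<tau> (block e))}
      = {\<tau> \<in> bounded_assignments p l. fibre_partition p \<tau> \<in> GELO p}"
    by (simp add: fibre_partition_in_GELO_iff)
  \<comment> \<open>Satisfiability is automatic: \<open>\<tau>\<close> itself witnesses that its
    partition lies in \<open>CSat p\<close>.\<close>
  also have "\<dots> = {\<tau> \<in> bounded_assignments p l. fibre_partition p \<tau> \<in> CCon p}"
  proof -
    have "fibre_partition p \<tau> \<in> CSat p" if "\<tau> \<in> bounded_assignments p l" for \<tau>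
      using that CAs_eq_len_iff[OF fibre_partition_in_Coh] fibre_partition_in_Coh
      by (fastforce simp: CSat_def CAs_eq_len_def)
    then show ?thesis by (auto simp: CCon_def)
  qed
  also have "\<dots> = (\<Union>P\<in>CCon p. CAs_eq_len p P l)"
    using coh by (auto simp: CAs_eq_len_iff)
  finally have "pair_central_moment p l (\<lambda>(f, g). SSCC f g)
      = real (card (\<Union>P\<in>CCon p. CAs_eq_len p P l))"
    by (simp add: central_moment_eq_card)
  also have "card (\<Union>P\<in>CCon p. CAs_eq_len p P l) = (\<Sum>P\<in>CCon p. card (CAs_eq_len p P l))"
  proof (rule card_UN_disjoint[OF fin])
    show "\<forall>P\<in>CCon p. finite (CAs_eq_len p P l)"
      using coh by (auto simp: CAs_eq_len_iff intro: finite_subset[OF _ finite_bounded_assignments])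
    \<comment> \<open>A common element \<open>\<tau>\<close> would force both partitions to equal
      \<open>fibre_partition p \<tau>\<close>.\<close>
    show "\<forall>P\<in>CCon p. \<forall>Q\<in>CCon p. P \<noteq> Q \<longrightarrow> CAs_eq_len p P l \<inter> CAs_eq_len p Q l = {}"
      using coh by (auto simp: CAs_eq_len_iff)
  qed
  finally show ?thesis by simp
qed

end
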